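(* Let $H$ be an arbitrary (finite, simple, nonempty) graph and let $n\in\mathbb{N}$. Then there exists a connected graph $G$ and a root $R_G$ of $G$ with $|V(R_G)|=n$ such that $H$ is isomorphic to $Res(G,R_G)$.
   Context: For a connected finite graph $G$ and a nonempty set $V_0\subseteq V(G)$, the distance partition $\{V_0,V_1,\dots,V_r\}$ of $V(G)$ is defined recursively by $V_{i+1}=\{v\in V(G)\setminus(V_0\cup\dots\cup V_i) : v \text{ is adjacent to some } u\in V_i\}$, with all $V_i$ nonempty; thus $V_i$ is the set of vertices at distance exactly $i$ from $V_0$. The root is the induced subgraph $R_G=\langle V_0\rangle$ and the distance-residual graph is the induced subgraph $Res(G,R_G)=\langle V_r\rangle$ on the last (farthest) class. *)

theory Defs
  imports "Graph_Theory.Digraph_Isomorphism"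
begin

text \<open>
  A finite simple graph is a symmetric digraph without loops and parallel arcs, i.e. an instance
  of the locale \<^locale>\<open>graph\<close>; adjacency is \<^const>\<open>dominates\<close>.
\<close>

fun dist_class :: "('a, 'b) pre_digraph \<Rightarrow> 'a set \<Rightarrow> nat \<Rightarrow> 'a set" where
  "dist_class G V0 0 = V0"
| "dist_class G V0 (Suc i) =
     {v \<in> verts G - (\<Union>j\<in>{..i}. dist_class G V0 j). \<exists>u\<in>dist_class G V0 i. u \<rightarrow>\<^bsub>G\<^esub> v}"

text \<open>
  In a finite graph with nonempty \<open>V0 \<subseteq> verts G\<close> the set below is finite and nonempty, because the
  classes are pairwise disjoint subsets of the vertex set and class 0 is \<open>V0\<close>.
\<close>

definition last_class_index :: "('a, 'b) pre_digraph \<Rightarrow> 'a set \<Rightarrow> nat" where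
  "last_class_index G V0 = Max {i. dist_class G V0 i \<noteq> {}}"

definition is_root :: "('a, 'b) pre_digraph \<Rightarrow> ('a, 'b) pre_digraph \<Rightarrow> bool" where
  "is_root R G \<longleftrightarrow> induced_subgraph R G \<and> verts R \<noteq> {}"

definition distance_residual ::
  "('a, 'b) pre_digraph \<Rightarrow> ('a, 'b) pre_digraph \<Rightarrow> ('a, 'b) pre_digraph" where
  "distance_residual G R = G \<restriction> dist_class G (verts R) (last_class_index G (verts R))"

end

theory Submission
  imports Defs
begin

text \<open>
  In the join of two disjoint nonempty graphs every vertex of one part is adjacent to every vertex
  of the other. The distance partition rooted at one part therefore consists of the two parts, and
  the other part is the residual graph. It remains to join a copy of \<open>H\<close> to an edgeless root on
  \<open>n\<close> vertices.
\<close>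

lemma dist_class_eq_empty_mono:
  assumes "dist_class G U i = {}" "i \<le> j"
  shows "dist_class G U j = {}"
  using assms(2,1) by (induction rule: dec_induct) simp_all

lemma last_class_index_eqI:
  assumes "dist_class G U k \<noteq> {}" "dist_class G U (Suc k) = {}"
  shows "last_class_index G U = k"
proof -
  have bound: "i \<le> k" if "dist_class G U i \<noteq> {}" for i
    using that dist_class_eq_empty_mono[OF assms(2)] not_less_eq_eq by metis
  then have "{i. dist_class G U i \<noteq> {}} \<subseteq> {..k}"
    by blast
  then have "finite {i. dist_class G U i \<noteq> {}}"
    by (rule finite_subset) simp
  then show ?thesis
    unfolding last_class_index_def by (rule Max_eqI) (use assms(1) bound in blast)+
qed

definition dominating_set :: "('a, 'b) pre_digraph \<Rightarrow> 'a set \<Rightarrow> bool" where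
  "dominating_set G U \<longleftrightarrow> U \<subseteq> verts G \<and> (\<forall>v\<in>verts G - U. \<exists>u\<in>U. u \<rightarrow>\<^bsub>G\<^esub> v)"

lemma dist_class_1_dominating_set:
  assumes "dominating_set G U"
  shows "dist_class G U (Suc 0) = verts G - U"
  using assms by (auto simp: dominating_set_def)

lemma distance_residual_dominating_set:
  assumes "dominating_set G (verts R)" "verts R \<noteq> verts G"
  shows "distance_residual G R = G \<restriction> (verts G - verts R)"
proof -
  note class_1 = dist_class_1_dominating_set[OF assms(1)]
  have "dist_class G (verts R) (Suc (Suc 0)) = {}"
    unfolding dist_class.simps(2)[of _ _ "Suc 0"] atMost_Suc atMost_0
    using class_1 by auto
  moreover have "dist_class G (verts R) (Suc 0) \<noteq> {}"
    unfolding class_1 using assms by (auto simp: dominating_set_def)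
  ultimately have "last_class_index G (verts R) = Suc 0"
    by (intro last_class_index_eqI)
  then show ?thesis
    by (simp only: distance_residual_def class_1)
qed

lemma (in wf_digraph) strongly_connected_imp_connected:
  assumes "strongly_connected G"
  shows "Digraph_Component.connected G"
  using assms
  by (auto simp: Digraph_Component.connected_def strongly_connected_def reachable_mk_symmetricI)

definition pair_join ::
  "'a pair_pre_digraph \<Rightarrow> 'a pair_pre_digraph \<Rightarrow> 'a pair_pre_digraph" where
  "pair_join P Q =
     \<lparr>pverts = pverts P \<union> pverts Q,
      parcs = parcs P \<union> parcs Q \<union> pverts P \<times> pverts Q \<union> pverts Q \<times> pverts P\<rparr>"

lemma pverts_pair_join [simp]: "pverts (pair_join P Q) = pverts P \<union> pverts Q"
  and parcs_pair_join [simp]: "parcs (pair_join P Q) =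
    parcs P \<union> parcs Q \<union> pverts P \<times> pverts Q \<union> pverts Q \<times> pverts P"
  by (simp_all add: pair_join_def)

lemma pair_join_commute: "pair_join P Q = pair_join Q P"
  by (simp add: pair_join_def Un_ac)

lemma pair_wf_digraph_pair_join:
  assumes "pair_wf_digraph P" "pair_wf_digraph Q"
  shows "pair_wf_digraph (pair_join P Q)"
  using assms by (auto simp: pair_wf_digraph_def)

lemma pair_graph_pair_join:
  assumes "pair_graph P" "pair_graph Q" "pverts P \<inter> pverts Q = {}"
  shows "pair_graph (pair_join P Q)"
proof -
  interpret P: pair_graph P by fact
  interpret Q: pair_graph Q by fact
  interpret pair_wf_digraph "pair_join P Q"
    by (intro pair_wf_digraph_pair_join P.pair_wf_digraph Q.pair_wf_digraph)
  show ?thesis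
  proof
    show "symmetric (with_proj (pair_join P Q))"
      by (auto simp: symmetric_def intro!: symI dest: P.arcs_symmetric Q.arcs_symmetric)
  qed (use assms(3) in \<open>auto dest: P.no_loops' Q.no_loops'\<close>)
qed

lemma connected_pair_join:
  assumes "pair_wf_digraph P" "pair_wf_digraph Q" "pverts P \<noteq> {}" "pverts Q \<noteq> {}"
  shows "Digraph_Component.connected (with_proj (pair_join P Q))"
proof -
  interpret pair_wf_digraph "pair_join P Q"
    using assms by (intro pair_wf_digraph_pair_join)
  let ?G = "with_proj (pair_join P Q)"
  have across: "x \<rightarrow>\<^sup>*\<^bsub>?G\<^esub> y"
    if "x \<in> pverts P \<and> y \<in> pverts Q \<or> x \<in> pverts Q \<and> y \<in> pverts P" for x y
    using that by (intro reachable_adjI) auto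
  obtain p q where "p \<in> pverts P" "q \<in> pverts Q"
    using assms(3,4) by blast
  then have "x \<rightarrow>\<^sup>*\<^bsub>?G\<^esub> y" if "x \<in> pverts P \<union> pverts Q" "y \<in> pverts P \<union> pverts Q" for x y
    using that across reachable_trans by (metis UnE)
  then have "strongly_connected ?G"
    using assms(3) by (intro strongly_connectedI) auto
  then show ?thesis
    by (rule strongly_connected_imp_connected)
qed

lemma dominating_set_pair_join:
  assumes "pverts P \<noteq> {}"
  shows "dominating_set (with_proj (pair_join P Q)) (pverts P)"
  using assms by (auto simp: dominating_set_def)

lemma induce_subgraph_pair_join:
  assumes "pair_wf_digraph P" "pair_wf_digraph Q" "pverts P \<inter> pverts Q = {}"
  shows "with_proj (pair_join P Q) \<restriction> pverts P = with_proj P"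
proof -
  interpret P: pair_wf_digraph P by fact
  interpret Q: pair_wf_digraph Q by fact
  have "{e \<in> parcs (pair_join P Q). fst e \<in> pverts P \<and> snd e \<in> pverts P} = parcs P"
    using assms(3) P.wellformed' Q.wellformed' by auto
  then show ?thesis
    by (simp add: induce_subgraph_def with_proj_def del: parcs_pair_join)
qed

lemma is_root_pair_join:
  assumes "pair_wf_digraph P" "pair_wf_digraph Q" "pverts P \<inter> pverts Q = {}" "pverts P \<noteq> {}"
  shows "is_root (with_proj P) (with_proj (pair_join P Q))"
proof -
  interpret pair_wf_digraph "pair_join P Q"
    using assms by (intro pair_wf_digraph_pair_join)
  have "induced_subgraph (with_proj (pair_join P Q) \<restriction> pverts P) (with_proj (pair_join P Q))"
    by (intro induced_induce) simp
  then show ?thesis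
    using assms by (simp add: is_root_def induce_subgraph_pair_join)
qed

lemma distance_residual_pair_join:
  assumes "pair_wf_digraph P" "pair_wf_digraph Q" "pverts P \<inter> pverts Q = {}"
    and "pverts P \<noteq> {}" "pverts Q \<noteq> {}"
  shows "distance_residual (with_proj (pair_join P Q)) (with_proj P) = with_proj Q"
proof -
  have complement: "pverts (pair_join P Q) - pverts P = pverts Q"
    using assms(3) by auto
  then have "distance_residual (with_proj (pair_join P Q)) (with_proj P) =
      with_proj (pair_join P Q) \<restriction> pverts Q"
    using distance_residual_dominating_set[of "with_proj (pair_join P Q)" "with_proj P"]
      dominating_set_pair_join[OF assms(4)] assms(5) by force
  also have "\<dots> = with_proj (pair_join Q P) \<restriction> pverts Q"
    by (simp only: pair_join_commute)
  also have "\<dots> = with_proj Q"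
    using assms by (intro induce_subgraph_pair_join) auto
  finally show ?thesis .
qed

definition pair_map :: "('a \<Rightarrow> 'c) \<Rightarrow> ('a, 'b) pre_digraph \<Rightarrow> 'c pair_pre_digraph" where
  "pair_map f G = \<lparr>pverts = f ` verts G, parcs = map_prod f f ` arcs_ends G\<rparr>"

lemma pverts_pair_map [simp]: "pverts (pair_map f G) = f ` verts G"
  and parcs_pair_map [simp]: "parcs (pair_map f G) = map_prod f f ` arcs_ends G"
  by (simp_all add: pair_map_def)

lemma (in graph) pair_graph_pair_map:
  assumes "inj_on f (verts G)"
  shows "pair_graph (pair_map f G)"
proof
  show "symmetric (with_proj (pair_map f G))"
    using arcs_ends_symmetric[OF sym_arcs] by (force simp: symmetric_def intro!: symI)
next
  fix e assume "e \<in> parcs (pair_map f G)"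
  then show "fst e \<noteq> snd e"
    using assms no_loops by (auto simp: arcs_ends_conv inj_on_eq_iff)
qed (auto simp: arcs_ends_conv)

lemma (in nomulti_digraph) digraph_iso_pair_map:
  assumes "inj_on f (verts G)"
  shows "digraph_iso G (with_proj (pair_map f G))"
proof -
  let ?iso = "\<lparr>iso_verts = f, iso_arcs = map_prod f f \<circ> arc_to_ends G,
    iso_head = snd, iso_tail = fst\<rparr>"
  have "arc_to_ends G ` arcs G \<subseteq> verts G \<times> verts G"
    by (auto simp: arc_to_ends_def)
  then have "inj_on (map_prod f f \<circ> arc_to_ends G) (arcs G)"
    using assms by (intro comp_inj_on inj_on_arc_to_ends inj_on_subset[OF map_prod_inj_on])
  then have "digraph_isomorphism ?iso"
    using assms wf_digraph by (simp add: digraph_isomorphism_def arc_to_ends_def)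
  moreover have "with_proj (pair_map f G) = app_iso ?iso G"
    by (simp add: with_proj_def app_iso_def arcs_ends_def image_comp)
  ultimately show ?thesis
    unfolding digraph_iso_def by blast
qed

lemma (in graph) ex_pair_graph_iso_disjoint:
  assumes "infinite (UNIV :: 'c set)" "finite (A :: 'c set)"
  shows "\<exists>P :: 'c pair_pre_digraph.
    pair_graph P \<and> pverts P \<inter> A = {} \<and> digraph_iso G (with_proj P)"
proof -
  have "infinite (- A)"
    using assms by (simp add: Compl_eq_Diff_UNIV)
  then obtain B where B: "finite B" "card B = card (verts G)" "B \<subseteq> - A"
    using infinite_arbitrarily_large by blast
  then obtain f where f: "bij_betw f (verts G) B"
    using finite_same_card_bij[OF finite_verts] by metis
  then have inj: "inj_on f (verts G)" and disjoint: "pverts (pair_map f G) \<inter> A = {}"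
    using B(3) by (auto simp: bij_betw_def)
  then show ?thesis
    using pair_graph_pair_map digraph_iso_pair_map by blast
qed

lemma verts_eq_empty_iff_digraph_iso:
  assumes "digraph_iso G H"
  shows "verts H = {} \<longleftrightarrow> verts G = {}"
  using assms by (auto simp: digraph_iso_def)

definition pair_edgeless :: "'a set \<Rightarrow> 'a pair_pre_digraph" where
  "pair_edgeless U = \<lparr>pverts = U, parcs = {}\<rparr>"

lemma pverts_pair_edgeless [simp]: "pverts (pair_edgeless U) = U"
  by (simp add: pair_edgeless_def)

lemma pair_graph_pair_edgeless:
  assumes "finite U"
  shows "pair_graph (pair_edgeless U)"
  using assms by unfold_locales (simp_all add: pair_edgeless_def symmetric_def)

theorem theorem1:
  fixes H :: "('a, 'b) pre_digraph" and n :: nat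
  assumes "graph H" and "verts H \<noteq> {}" and "n \<ge> 1"
  shows "\<exists>(G :: (nat, nat \<times> nat) pre_digraph) R.
           graph G \<and> Digraph_Component.connected G \<and> is_root R G \<and> card (verts R) = n \<and>
           digraph_iso H (distance_residual G R)"
proof -
  obtain P :: "nat pair_pre_digraph"
    where P: "pair_graph P" "pverts P \<inter> {..<n} = {}" "digraph_iso H (with_proj P)"
    using graph.ex_pair_graph_iso_disjoint[OF assms(1), of "{..<n}"] by auto
  define R where "R = pair_edgeless {..<n}"
  have R: "pair_graph R" "card (pverts R) = n"
    by (simp_all add: R_def pair_graph_pair_edgeless)
  have disjoint: "pverts R \<inter> pverts P = {}"
    using P(2) by (auto simp: R_def)
  have nonempty: "pverts R \<noteq> {}" "pverts P \<noteq> {}"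
    using assms(2,3) verts_eq_empty_iff_digraph_iso[OF P(3)]
    by (auto simp: R_def lessThan_empty_iff)
  have wf: "pair_wf_digraph R" "pair_wf_digraph P"
    using R(1) P(1) by (simp_all add: pair_graph_def pair_digraph.pair_wf_digraph)
  let ?G = "with_proj (pair_join R P)"
  have "graph ?G"
    using R(1) P(1) disjoint by (intro pair_graph.pair_graphD_graph pair_graph_pair_join)
  moreover have "digraph_iso H (distance_residual ?G (with_proj R))"
    using P(3) by (simp only: distance_residual_pair_join[OF wf disjoint nonempty])
  ultimately show ?thesis
    using connected_pair_join[OF wf nonempty] is_root_pair_join[OF wf disjoint nonempty(1)] R(2)
    by (intro exI[of _ ?G] exI[of _ "with_proj R"]) simp
qed

end
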